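(* For every integer $n\ge 1$, $$\mathrm{pf}_n(132,321)=C_n+\sum_{m=1}^{n-1}(n-m)\,h_{n,m},$$ where $C_n=\frac{1}{n+1}\binom{2n}{n}$ is the $n$th Catalan number and $h_{n,m}$ is the number of Dyck paths of semilength $n$ in which the $m$th north step is immediately followed by an east step.
   Context: A Dyck path of semilength $n$ is a lattice path from $(0,0)$ to $(n,n)$ consisting of $n$ north steps $N=(0,1)$ and $n$ east steps $E=(1,0)$ that never goes below the line $y=x$. A parking function of size $n$ is a Dyck path of semilength $n$ whose $n$ north steps are labeled bijectively by $\{1,\dots,n\}$ so that whenever two north steps are consecutive in the path (one immediately following the other), the label of the later one is larger. For a parking function $p$ of size $n$, $\phi(p)$ is the permutation of $\{1,\dots,n\}$ (in one-line notation) obtained by reading the labels of the north steps in the order they occur along the path. A permutation $\pi$ of $\{1,\dots,n\}$ contains a permutation $\rho$ of $\{1,\dots,m\}$ if there are indices $1\le i_1<\cdots<i_m\le n$ such that $\pi_{i_a}\le\pi_{i_b}$ if and only if $\rho_a\le\rho_b$; otherwise $\pi$ avoids $\rho$. For permutations $\rho_1,\dots,\rho_r$, $\mathrm{pf}_n(\rho_1,\dots,\rho_r)$ denotes the number of parking functions $p$ of size $n$ such that $\phi(p)$ avoids each of $\rho_1,\dots,\rho_r$. North steps of a path are numbered $1,\dots,n$ in the order they occur along the path. *)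

theory Defs
  imports Complex_Main
begin

datatype step = North | East

text \<open>
  A path is the word of its steps, read from the origin. Its vertex after \<open>k\<close> steps is
  \<open>(number of East, number of North)\<close> in \<open>take k w\<close>, so weakly above the diagonal means
  that no prefix contains more \<open>East\<close> than \<open>North\<close>.
\<close>

definition dyck_path :: "nat \<Rightarrow> step list \<Rightarrow> bool" where
  "dyck_path n w \<longleftrightarrow>
     count_list w North = n \<and> count_list w East = n \<and>
     (\<forall>k\<le>length w. count_list (take k w) East \<le> count_list (take k w) North)"

datatype labelled_step = LNorth nat | LEast

fun unlabel :: "labelled_step \<Rightarrow> step" where
  "unlabel (LNorth a) = North"
| "unlabel LEast = East"

text \<open>The labels of the north steps, in the order in which these occur along the path.\<close>

fun north_labels :: "labelled_step list \<Rightarrow> nat list" where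
  "north_labels [] = []"
| "north_labels (LNorth a # p) = a # north_labels p"
| "north_labels (LEast # p) = north_labels p"

definition parking_function :: "nat \<Rightarrow> labelled_step list \<Rightarrow> bool" where
  "parking_function n p \<longleftrightarrow>
     dyck_path n (map unlabel p) \<and>
     distinct (north_labels p) \<and> set (north_labels p) = {1..n} \<and>
     (\<forall>i a b. Suc i < length p \<and> p ! i = LNorth a \<and> p ! Suc i = LNorth b \<longrightarrow> a < b)"

text \<open>Permutations are in one-line notation; list positions count from \<open>0\<close>.\<close>

definition contains_pattern :: "nat list \<Rightarrow> nat list \<Rightarrow> bool" where
  "contains_pattern \<pi> \<rho> \<longleftrightarrow>
     (\<exists>f :: nat \<Rightarrow> nat.
        strict_mono_on {..<length \<rho>} f \<and> f ` {..<length \<rho>} \<subseteq> {..<length \<pi>} \<and>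
        (\<forall>a<length \<rho>. \<forall>b<length \<rho>. \<pi> ! f a \<le> \<pi> ! f b \<longleftrightarrow> \<rho> ! a \<le> \<rho> ! b))"

definition avoids_pattern :: "nat list \<Rightarrow> nat list \<Rightarrow> bool" where
  "avoids_pattern \<pi> \<rho> \<longleftrightarrow> \<not> contains_pattern \<pi> \<rho>"

definition pf :: "nat \<Rightarrow> nat list list \<Rightarrow> nat" where
  "pf n \<rho>s =
     card {p. parking_function n p \<and> (\<forall>\<rho>\<in>set \<rho>s. avoids_pattern (north_labels p) \<rho>)}"

definition catalan :: "nat \<Rightarrow> real" where
  "catalan n = 1 / (real n + 1) * real ((2 * n) choose n)"

text \<open>
  The step at list position \<open>i\<close> is the \<open>m\<close>-th north step (counting from \<open>1\<close>) iff it is a north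
  step and the first \<open>i + 1\<close> steps contain exactly \<open>m\<close> north steps.
\<close>

definition north_then_east :: "nat \<Rightarrow> step list \<Rightarrow> bool" where
  "north_then_east m w \<longleftrightarrow>
     (\<exists>i. Suc i < length w \<and> w ! i = North \<and> count_list (take (Suc i) w) North = m \<and>
          w ! Suc i = East)"

definition h :: "nat \<Rightarrow> nat \<Rightarrow> nat" where
  "h n m = card {w. dyck_path n w \<and> north_then_east m w}"

end

(*
  A permutation of {1..n} avoiding 132 and 321 is either the identity or of the form
  c+1, ..., c+m, 1, ..., c, c+m+1, ..., n with m, c >= 1; the latter has its only descent at
  position m, and for given m there are n - m choices of c. A Dyck path can be labelled by such a
  permutation exactly when no two consecutive north steps sit at the descent, that is, when the
  m-th north step is followed by an east step; the identity fits every Dyck path.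
*)

theory Submission
  imports Defs
begin

section \<open>Counting Dyck paths\<close>

text \<open>The numbers of north and east steps are decoupled so that deleting the last step stays
  inside the family; Dyck paths are the case \<open>a = b = n\<close>.\<close>

definition ballot_paths :: "nat \<Rightarrow> nat \<Rightarrow> step list set" where
  "ballot_paths a b =
     {w. count_list w North = a \<and> count_list w East = b \<and>
         (\<forall>k\<le>length w. count_list (take k w) East \<le> count_list (take k w) North)}"

lemma all_prefixes_snoc:
  "(\<forall>k\<le>length (w @ [s]). P (take k (w @ [s]))) \<longleftrightarrow> (\<forall>k\<le>length w. P (take k w)) \<and> P (w @ [s])"
  by (auto simp: le_Suc_eq)

lemma length_eq_counts: "length w = count_list w North + count_list w East"
proof (induction w)
  case (Cons s w)
  then show ?case by (cases s) auto
qed simp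

lemma finite_ballot_paths: "finite (ballot_paths a b)"
proof (rule finite_subset)
  show "ballot_paths a b \<subseteq> {w. set w \<subseteq> {North, East} \<and> length w = a + b}"
    by (auto simp: ballot_paths_def length_eq_counts intro: step.exhaust)
  show "finite {w. set w \<subseteq> {North, East} \<and> length w = a + b}"
    by (rule finite_lists_length_eq) simp
qed

lemma ballot_paths_snoc_North:
  "w @ [North] \<in> ballot_paths a b \<longleftrightarrow> a > 0 \<and> b \<le> a \<and> w \<in> ballot_paths (a - 1) b"
  unfolding ballot_paths_def mem_Collect_eq
    all_prefixes_snoc[where P = "\<lambda>u. count_list u East \<le> count_list u North"]
  by auto

lemma ballot_paths_snoc_East:
  "w @ [East] \<in> ballot_paths a b \<longleftrightarrow> b > 0 \<and> b \<le> a \<and> w \<in> ballot_paths a (b - 1)"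
  unfolding ballot_paths_def mem_Collect_eq
    all_prefixes_snoc[where P = "\<lambda>u. count_list u East \<le> count_list u North"]
  by auto

text \<open>The whole word is one of its own prefixes, so the prefix condition already forces
  \<open>b \<le> a\<close>.\<close>

lemma ballot_paths_below_diagonal: "a < b \<Longrightarrow> ballot_paths a b = {}"
  unfolding ballot_paths_def by (fastforce dest: spec[where x = "length _"])

lemma ballot_paths_0_right: "ballot_paths a 0 = {replicate a North}"
proof -
  have "w = replicate (count_list w North) North" if "count_list w East = 0" for w
    using that
  proof (induction w)
    case (Cons s w)
    then show ?case by (cases s) auto
  qed simp
  moreover have "count_list (replicate k North) East = 0" "count_list (replicate k North) North = k" for k
    by (induction k) auto
  ultimately show ?thesis
    by (auto simp: ballot_paths_def)
qed

text \<open>Split by the last step. The hypothesis puts the endpoint weakly above the diagonal; when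
  \<open>a = b\<close>, no path ends in a north step and the first summand is zero.\<close>

lemma card_ballot_paths_rec:
  assumes "b \<le> a"
  shows "card (ballot_paths (Suc a) (Suc b)) =
           card (ballot_paths a (Suc b)) + card (ballot_paths (Suc a) b)"
proof -
  let ?N = "(\<lambda>w. w @ [North]) ` ballot_paths a (Suc b)"
  let ?E = "(\<lambda>w. w @ [East]) ` ballot_paths (Suc a) b"
  have "w \<in> ballot_paths (Suc a) (Suc b) \<longleftrightarrow> w \<in> ?N \<union> ?E" for w
  proof (cases w rule: rev_cases)
    case Nil
    then show ?thesis by (auto simp: ballot_paths_def)
  next
    case (snoc u s)
    then show ?thesis
      using assms by (cases s) (auto simp: ballot_paths_snoc_North ballot_paths_snoc_East)
  qed
  then have "ballot_paths (Suc a) (Suc b) = ?N \<union> ?E"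
    by blast
  moreover have "card (?N \<union> ?E) = card ?N + card ?E"
    by (rule card_Un_disjoint) (auto simp: finite_ballot_paths)
  ultimately show ?thesis
    by (simp add: card_image inj_on_def)
qed

text \<open>The ballot numbers as a difference of two binomials, stated additively to avoid
  truncated subtraction. Both sides obey Pascal's rule. The case \<open>a = b\<close>, an endpoint
  just below the diagonal, is a boundary value: there is no path, and the two binomials agree by
  symmetry.\<close>

lemma card_ballot_paths:
  assumes "b \<le> a"
  shows "card (ballot_paths a (Suc b)) + ((a + Suc b) choose b) = (a + Suc b) choose Suc b"
  using assms
proof (induction "a + b" arbitrary: a b rule: less_induct)
  case less
  show ?case
  proof (cases "a = b")
    case True
    then show ?thesis
      using binomial_symmetric[of b "b + Suc b"] by (simp add: ballot_paths_below_diagonal)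
  next
    case False
    with less.prems obtain a' where a: "a = Suc a'" and le: "b \<le> a'"
      by (cases a) auto
    note IH = less.hyps[of a' b]
    show ?thesis
    proof (cases b)
      case 0
      then show ?thesis
        using IH card_ballot_paths_rec[OF le] a by (simp add: ballot_paths_0_right)
    next
      case (Suc b')
      then show ?thesis
        using IH less.hyps[of a b'] card_ballot_paths_rec[OF le] a le by simp
    qed
  qed
qed

lemma card_dyck_paths: "real (card {w. dyck_path n w}) = catalan n"
proof -
  have eq: "{w. dyck_path n w} = ballot_paths n n"
    by (auto simp: dyck_path_def ballot_paths_def)
  show ?thesis
  \<comment> \<open>The ballot formula has a successor as its second index, so the empty path is
    treated separately.\<close>
  proof (cases n)
    case 0
    then show ?thesis
      unfolding eq by (simp add: ballot_paths_0_right catalan_def)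
  next
    case (Suc b)
    let ?B = "(2 * n) choose n"
    have "card (ballot_paths n n) + ((2 * n) choose b) = ?B"
      using card_ballot_paths[of b n] Suc by (simp add: mult_2)
    then have sum: "real (card (ballot_paths n n)) = real ?B - real ((2 * n) choose b)"
      by linarith
    \<comment> \<open>Here \<open>b = n - 1\<close>, and by the two absorption identities both sides
      equal \<open>2 * n * ((2 * n - 1) choose b)\<close>.\<close>
    have "(2 * n - b) * ((2 * n) choose b) = n * ?B"
      using binomial_absorb_comp[of "2 * n" b] binomial_absorption[of b "2 * n"] Suc by simp
    then have "(n + 1) * ((2 * n) choose b) = n * ?B"
      using Suc by simp
    then have "(real n + 1) * real ((2 * n) choose b) = real n * real ?B"
      by (metis of_nat_1 of_nat_add of_nat_mult)
    then show ?thesis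
      unfolding eq sum catalan_def by (simp add: field_simps)
  qed
qed

lemma finite_dyck_paths: "finite {w. dyck_path n w}"
  using finite_ballot_paths[of n n] by (simp add: dyck_path_def ballot_paths_def)

section \<open>Permutations avoiding 132 and 321\<close>

text \<open>The embedding is replaced by its values at 0, 1 and 2. Comparisons of an index with
  itself are trivial, which leaves six.\<close>

lemma contains_pattern_length3:
  "contains_pattern \<pi> [x, y, z] \<longleftrightarrow>
    (\<exists>i j k. i < j \<and> j < k \<and> k < length \<pi> \<and>
       (\<pi> ! i \<le> \<pi> ! j \<longleftrightarrow> x \<le> y) \<and> (\<pi> ! j \<le> \<pi> ! i \<longleftrightarrow> y \<le> x) \<and>
       (\<pi> ! i \<le> \<pi> ! k \<longleftrightarrow> x \<le> z) \<and> (\<pi> ! k \<le> \<pi> ! i \<longleftrightarrow> z \<le> x) \<and>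
       (\<pi> ! j \<le> \<pi> ! k \<longleftrightarrow> y \<le> z) \<and> (\<pi> ! k \<le> \<pi> ! j \<longleftrightarrow> z \<le> y))"
    (is "_ \<longleftrightarrow> (\<exists>i j k. ?Q i j k)")
proof
  assume "contains_pattern \<pi> [x, y, z]"
  then obtain f where "strict_mono_on {..<3} f" "f ` {..<3} \<subseteq> {..<length \<pi>}"
    and "\<forall>a<3. \<forall>b<3. \<pi> ! f a \<le> \<pi> ! f b \<longleftrightarrow> [x, y, z] ! a \<le> [x, y, z] ! b"
    by (auto simp: contains_pattern_def numeral_3_eq_3)
  then have "?Q (f 0) (f 1) (f 2)"
    by (auto simp: strict_mono_on_def numeral_3_eq_3 numeral_2_eq_2 All_less_Suc image_subset_iff)
  then show "\<exists>i j k. ?Q i j k"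
    by blast
next
  assume "\<exists>i j k. ?Q i j k"
  then obtain i j k where Q: "?Q i j k"
    by blast
  let ?f = "\<lambda>a::nat. [i, j, k] ! a"
  have "strict_mono_on {..<3} ?f" "?f ` {..<3} \<subseteq> {..<length \<pi>}"
    using Q by (auto simp: strict_mono_on_def numeral_3_eq_3 less_Suc_eq)
  moreover have "\<forall>a<3. \<forall>b<3. \<pi> ! ?f a \<le> \<pi> ! ?f b \<longleftrightarrow> [x, y, z] ! a \<le> [x, y, z] ! b"
    using Q by (simp add: numeral_3_eq_3 All_less_Suc)
  ultimately show "contains_pattern \<pi> [x, y, z]"
    unfolding contains_pattern_def by (intro exI[of _ ?f]) (simp add: numeral_3_eq_3)
qed

text \<open>Two strict inequalities suffice, since the comparison of positions \<open>i\<close> and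
  \<open>j\<close> follows by transitivity. The curried form is meant for instantiation at explicit
  indices.\<close>

lemma avoids_132_iff:
  "avoids_pattern \<pi> [1, 3, 2] \<longleftrightarrow>
     (\<forall>i j k. i < j \<longrightarrow> j < k \<longrightarrow> k < length \<pi> \<longrightarrow> \<pi> ! i < \<pi> ! k \<longrightarrow> \<not> \<pi> ! k < \<pi> ! j)"
proof -
  have "contains_pattern \<pi> [1, 3, 2] \<longleftrightarrow>
      (\<exists>i j k. i < j \<and> j < k \<and> k < length \<pi> \<and> \<pi> ! i < \<pi> ! k \<and> \<pi> ! k < \<pi> ! j)"
    unfolding contains_pattern_length3 by (intro ex_cong1) auto
  then show ?thesis
    unfolding avoids_pattern_def by blast
qed

lemma avoids_321_iff:
  "avoids_pattern \<pi> [3, 2, 1] \<longleftrightarrow>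
     (\<forall>i j k. i < j \<longrightarrow> j < k \<longrightarrow> k < length \<pi> \<longrightarrow> \<pi> ! j < \<pi> ! i \<longrightarrow> \<not> \<pi> ! k < \<pi> ! j)"
proof -
  have "contains_pattern \<pi> [3, 2, 1] \<longleftrightarrow>
      (\<exists>i j k. i < j \<and> j < k \<and> k < length \<pi> \<and> \<pi> ! j < \<pi> ! i \<and> \<pi> ! k < \<pi> ! j)"
    unfolding contains_pattern_length3 by (intro ex_cong1) auto
  then show ?thesis
    unfolding avoids_pattern_def by blast
qed

section \<open>Classification of the avoiding permutations\<close>

definition avoiders :: "nat \<Rightarrow> nat list set" where
  "avoiders n = {\<pi>. distinct \<pi> \<and> set \<pi> = {1..n} \<and>
     avoids_pattern \<pi> [1, 3, 2] \<and> avoids_pattern \<pi> [3, 2, 1]}"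

text \<open>The identity with its first \<open>c + m\<close> entries cyclically shifted. For
  \<open>c + m \<le> n\<close>, the degenerate values \<open>m = 0\<close> and \<open>c = 0\<close>
  give the identity back.\<close>

definition rotated :: "nat \<Rightarrow> nat \<Rightarrow> nat \<Rightarrow> nat list" where
  "rotated n m c = [c + 1..<c + m + 1] @ [1..<c + 1] @ [c + m + 1..<n + 1]"

lemma length_rotated: "c + m \<le> n \<Longrightarrow> length (rotated n m c) = n"
  by (simp add: rotated_def del: upt_Suc)

lemma nth_rotated:
  assumes "c + m \<le> n" "i < n"
  shows "rotated n m c ! i = (if i < m then c + 1 + i else if i < m + c then i - m + 1 else i + 1)"
  using assms by (auto simp: rotated_def nth_append simp del: upt_Suc)

text \<open>All three blocks increase, so an inversion can only pair an entry of the first block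
  with one of the second. Nothing after it is smaller than its lower entry, and everything before
  its upper entry is larger than its lower entry.\<close>

lemma rotated_in_avoiders:
  assumes "c + m \<le> n"
  shows "rotated n m c \<in> avoiders n"
proof -
  have "distinct (rotated n m c)"
    by (auto simp: rotated_def)
  moreover have "set (rotated n m c) = {1..n}"
    using assms by (auto simp: rotated_def)
  moreover have "avoids_pattern (rotated n m c) [1, 3, 2]"
    unfolding avoids_132_iff using assms by (auto simp: length_rotated nth_rotated)
  moreover have "avoids_pattern (rotated n m c) [3, 2, 1]"
    unfolding avoids_321_iff using assms by (auto simp: length_rotated nth_rotated)
  ultimately show ?thesis
    by (simp add: avoiders_def)
qed

text \<open>The only fall is from the end of the first block, \<open>c + m\<close>, to the start of
  the second, 1. Since list positions count from 0, this is between positions \<open>m - 1\<close>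
  and \<open>m\<close>.\<close>

lemma rotated_ascent_iff:
  assumes "c + m \<le> n" "1 \<le> c" "Suc j < n"
  shows "rotated n m c ! j < rotated n m c ! Suc j \<longleftrightarrow> Suc j \<noteq> m"
  using assms by (auto simp: nth_rotated)

lemma sorted_wrt_less_eq_upt:
  fixes xs :: "nat list"
  assumes "sorted_wrt (<) xs" "set xs = {a..<b}"
  shows "xs = [a..<b]"
  using assms by (intro strict_sorted_equal) auto

text \<open>An occurrence in the prefix \<open>xs\<close> keeps its indices in
  \<open>xs @ ys\<close>. This permits removing a maximum that stands last.\<close>

lemma avoids_pattern_appendD:
  assumes "avoids_pattern (xs @ ys) \<rho>"
  shows "avoids_pattern xs \<rho>"
  unfolding avoids_pattern_def
proof
  assume "contains_pattern xs \<rho>"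
  then obtain f where f: "strict_mono_on {..<length \<rho>} f" "f ` {..<length \<rho>} \<subseteq> {..<length xs}"
    "\<forall>a<length \<rho>. \<forall>b<length \<rho>. xs ! f a \<le> xs ! f b \<longleftrightarrow> \<rho> ! a \<le> \<rho> ! b"
    by (auto simp: contains_pattern_def)
  then have "contains_pattern (xs @ ys) \<rho>"
    unfolding contains_pattern_def
    by (intro exI[of _ f]) (auto simp: nth_append image_subset_iff trans_less_add1)
  with assms show False
    by (simp add: avoids_pattern_def)
qed

text \<open>
  Remove the maximum \<open>n\<close> while it is last. Once it is not, avoiding 132 puts everything before
  it above everything after it, and then avoiding 321 makes both parts increasing.
\<close>

lemma avoiders_cases:
  assumes "\<pi> \<in> avoiders n"
  shows "\<pi> = [1..<n + 1] \<or> (\<exists>m c. 1 \<le> m \<and> 1 \<le> c \<and> c + m \<le> n \<and> \<pi> = rotated n m c)"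
  using assms
proof (induction n arbitrary: \<pi>)
  case 0
  then show ?case by (simp add: avoiders_def)
next
  case (Suc n)
  then have dist: "distinct \<pi>" and set: "set \<pi> = {1..Suc n}"
    and av132: "avoids_pattern \<pi> [1, 3, 2]" and av321: "avoids_pattern \<pi> [3, 2, 1]"
    by (auto simp: avoiders_def)
  have "Suc n \<in> set \<pi>"
    using set by simp
  then obtain A B where \<pi>: "\<pi> = A @ Suc n # B"
    by (meson split_list)
  have AB: "set A \<union> set B = {1..n}"
  proof -
    have "set A \<union> set B = set \<pi> - {Suc n}"
      using dist by (auto simp: \<pi>)
    also have "\<dots> = {1..n}"
      by (auto simp: set)
    finally show ?thesis .
  qed
  have boundA: "1 \<le> x" "x \<le> n" if "x \<in> set A" for x
    using that AB by (metis UnI1 atLeastAtMost_iff)+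
  have boundB: "1 \<le> x" "x \<le> n" if "x \<in> set B" for x
    using that AB by (metis UnI2 atLeastAtMost_iff)+
  show ?case
  proof (cases "B = []")
    case True
    then have "A \<in> avoiders n"
      using dist AB av132 av321 unfolding \<pi>
      by (auto simp: avoiders_def dest: avoids_pattern_appendD)
    from Suc.IH[OF this] show ?thesis
    proof
      assume "A = [1..<n + 1]"
      then show ?thesis using True \<pi> by simp
    next
      assume "\<exists>m c. 1 \<le> m \<and> 1 \<le> c \<and> c + m \<le> n \<and> A = rotated n m c"
      then obtain m c where "1 \<le> m" "1 \<le> c" "c + m \<le> n" "A = rotated n m c"
        by blast
      \<comment> \<open>Appending the new maximum only lengthens the third block, so
        \<open>m\<close> and \<open>c\<close> stay the same.\<close>
      moreover from this have "\<pi> = rotated (Suc n) m c"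
        using True \<pi> by (simp add: rotated_def)
      ultimately show ?thesis
        by (metis le_Suc_eq)
    qed
  next
    case False
    have gt: "y < x" if xy: "x \<in> set A" "y \<in> set B" for x y
    proof -
      obtain i where i: "i < length A" "A ! i = x"
        using xy(1) by (meson in_set_conv_nth)
      obtain k where k: "k < length B" "B ! k = y"
        using xy(2) by (meson in_set_conv_nth)
      have "y < Suc n"
        using boundB[OF xy(2)] by simp
      moreover have "\<not> (x < y \<and> y < Suc n)"
        \<comment> \<open>The maximum, at position \<open>length A\<close>, acts as the 3 of a 132
          between \<open>x\<close> and \<open>y\<close>.\<close>
        using av132[unfolded avoids_132_iff, rule_format, of i "length A" "Suc (length A + k)"] i k
        by (auto simp: \<pi> nth_append)
      moreover have "x \<noteq> y"
        using xy dist by (auto simp: \<pi>)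
      ultimately show ?thesis by linarith
    qed
    have sA: "sorted_wrt (<) (A @ [Suc n])"
    proof -
      have "A ! i < A ! j" if "i < j" "j < length A" for i j
      proof -
        have "B ! 0 < A ! j"
          using gt[of "A ! j" "B ! 0"] that False by simp
        then have "\<not> A ! j < A ! i"
          \<comment> \<open>The first entry of \<open>B\<close>, at position
            \<open>Suc (length A)\<close>, lies below all of \<open>A\<close> and completes a
            descent inside \<open>A\<close> to a 321.\<close>
          using av321[unfolded avoids_321_iff, rule_format, of i j "Suc (length A)"] that False
          by (auto simp: \<pi> nth_append)
        moreover have "A ! i \<noteq> A ! j"
          using dist that by (simp add: \<pi> nth_eq_iff_index_eq)
        ultimately show ?thesis by linarith
      qed
      then have "sorted_wrt (<) A"
        by (simp add: sorted_wrt_iff_nth_less)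
      moreover have "\<forall>x\<in>set A. x < Suc n"
        using boundA by (simp add: less_Suc_eq_le)
      ultimately show ?thesis
        by (simp add: sorted_wrt_append)
    qed
    have sB: "sorted_wrt (<) B"
    proof -
      have "B ! i < B ! j" if "i < j" "j < length B" for i j
      proof -
        have "B ! i < Suc n"
          using boundB[of "B ! i"] that by simp
        then have "\<not> B ! j < B ! i"
          using av321[unfolded avoids_321_iff, rule_format, of "length A" "Suc (length A + i)"
              "Suc (length A + j)"] that
          by (auto simp: \<pi> nth_append)
        moreover have "B ! i \<noteq> B ! j"
          using dist that by (simp add: \<pi> nth_eq_iff_index_eq)
        ultimately show ?thesis by linarith
      qed
      then show ?thesis
        by (simp add: sorted_wrt_iff_nth_less)
    qed
    \<comment> \<open>As every entry of \<open>A\<close> exceeds every entry of \<open>B\<close>,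
      the set of \<open>B\<close> is an initial segment of \<open>{1..n}\<close>, and its maximum is
      the length of the second block.\<close>
    define c where "c = Max (set B)"
    have cB: "c \<in> set B" and cmax: "\<And>y. y \<in> set B \<Longrightarrow> y \<le> c"
      using False by (auto simp: c_def)
    have "1 \<le> c" "c \<le> n"
      using boundB[OF cB] by auto
    have "set B = {1..<c + 1}"
    proof (intro set_eqI iffI)
      fix y assume "y \<in> {1..<c + 1}"
      then have "y \<in> set A \<union> set B" "y \<le> c"
        using \<open>c \<le> n\<close> unfolding AB by auto
      then show "y \<in> set B"
        using gt[of y c] cB by auto
    next
      fix y assume "y \<in> set B"
      then show "y \<in> {1..<c + 1}"
        using cmax[of y] boundB[of y] by auto
    qed
    moreover have "set (A @ [Suc n]) = {c + 1..<Suc n + 1}"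
    proof (intro set_eqI iffI)
      fix x assume x: "x \<in> {c + 1..<Suc n + 1}"
      then have "x \<notin> set B" "x = Suc n \<or> x \<in> set A \<union> set B"
        using cmax[of x] unfolding AB by auto
      then show "x \<in> set (A @ [Suc n])"
        by auto
    next
      fix x assume "x \<in> set (A @ [Suc n])"
      then show "x \<in> {c + 1..<Suc n + 1}"
        using gt[of x c] cB boundA[of x] \<open>c \<le> n\<close> by auto
    qed
    ultimately have "A @ [Suc n] = [c + 1..<Suc n + 1]" "B = [1..<c + 1]"
      using sorted_wrt_less_eq_upt sA sB by blast+
    \<comment> \<open>The maximum closes the first block, which thus has \<open>Suc n - c\<close>
      entries, and the third block is empty.\<close>
    then have "\<pi> = rotated (Suc n) (Suc n - c) c"
      using \<open>c \<le> n\<close> by (simp add: \<pi> rotated_def)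
    then show ?thesis
      using \<open>1 \<le> c\<close> \<open>c \<le> n\<close> by (intro disjI2 exI[of _ "Suc n - c"] exI[of _ c]) auto
  qed
qed

lemma avoiders_eq:
  "avoiders n =
     insert [1..<n + 1] ((\<lambda>(m, c). rotated n m c) ` (SIGMA m:{1..n - 1}. {1..n - m}))"
proof (intro set_eqI iffI)
  fix \<pi> assume "\<pi> \<in> avoiders n"
  from avoiders_cases[OF this] show
    "\<pi> \<in> insert [1..<n + 1] ((\<lambda>(m, c). rotated n m c) ` (SIGMA m:{1..n - 1}. {1..n - m}))"
    by (force simp: image_iff)
next
  fix \<pi>
  assume "\<pi> \<in> insert [1..<n + 1] ((\<lambda>(m, c). rotated n m c) ` (SIGMA m:{1..n - 1}. {1..n - m}))"
  moreover have "[1..<n + 1] = rotated n 0 0"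
    by (simp add: rotated_def)
  ultimately show "\<pi> \<in> avoiders n"
    by (auto intro!: rotated_in_avoiders)
qed

text \<open>The first entry \<open>c + 1\<close> determines \<open>c\<close>, and the position of
  the only descent determines \<open>m\<close>.\<close>

lemma inj_on_rotated: "inj_on (\<lambda>(m, c). rotated n m c) (SIGMA m:{1..n - 1}. {1..n - m})"
proof (rule inj_onI, clarify)
  fix m c m' c'
  assume m: "m \<in> {1..n - 1}" "c \<in> {1..n - m}" and m': "m' \<in> {1..n - 1}" "c' \<in> {1..n - m'}"
    and eq: "rotated n m c = rotated n m' c'"
  have "rotated n m c ! 0 = c + 1" "rotated n m' c' ! 0 = c' + 1"
    using m m' by (auto simp: nth_rotated)
  then have "c = c'"
    using eq by simp
  moreover have "m = m'"
    using rotated_ascent_iff[of c m n "m - 1"] rotated_ascent_iff[of c' m' n "m - 1"] m m' eq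
    by auto
  ultimately show "m = m' \<and> c = c'" by simp
qed

lemma identity_not_rotated:
  "[1..<n + 1] \<notin> (\<lambda>(m, c). rotated n m c) ` (SIGMA m:{1..n - 1}. {1..n - m})"
proof clarify
  fix m c
  assume m: "m \<in> {1..n - 1}" "c \<in> {1..n - m}" and eq: "[1..<n + 1] = rotated n m c"
  have "rotated n m c ! 0 = c + 1"
    using m by (auto simp: nth_rotated)
  moreover have "[1..<n + 1] ! 0 = 1"
    using m by (subst nth_upt) auto
  ultimately show False
    using m eq by simp
qed

section \<open>Labelling the north steps of a path\<close>

text \<open>Inverse to splitting a labelled path into its word and its label list. With
  \<open>hd\<close> and \<open>tl\<close> the function is total; labels are meaningful only while
  the list lasts, hence the length condition when reading them back.\<close>

fun label_path :: "step list \<Rightarrow> nat list \<Rightarrow> labelled_step list" where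
  "label_path [] xs = []"
| "label_path (East # w) xs = LEast # label_path w xs"
| "label_path (North # w) xs = LNorth (hd xs) # label_path w (tl xs)"

lemma label_path_unlabel: "label_path (map unlabel p) (north_labels p) = p"
  by (induction p rule: north_labels.induct) auto

lemma unlabel_label_path: "map unlabel (label_path w xs) = w"
  by (induction w xs rule: label_path.induct) auto

lemma north_labels_label_path:
  "length xs = count_list w North \<Longrightarrow> north_labels (label_path w xs) = xs"
proof (induction w xs rule: label_path.induct)
  case (3 w xs)
  then show ?case by (cases xs) auto
qed auto

text \<open>The number of north steps before position \<open>i\<close> is the index, counted from 0,
  of the label at \<open>i\<close>.\<close>

lemma nth_labelled_north:
  assumes "i < length p" "map unlabel p ! i = North"
  shows "p ! i = LNorth (north_labels p ! count_list (take i (map unlabel p)) North)"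
  using assms
proof (induction p arbitrary: i rule: north_labels.induct)
  case (2 a p)
  then show ?case by (cases i) auto
next
  case (3 p)
  then show ?case by (cases i) auto
qed simp

text \<open>The label condition of a parking function on the pair of word and labels, so that for a
  fixed permutation it restricts the word alone.\<close>

definition labels_fit :: "step list \<Rightarrow> nat list \<Rightarrow> bool" where
  "labels_fit w xs \<longleftrightarrow>
     (\<forall>i. Suc i < length w \<and> w ! i = North \<and> w ! Suc i = North \<longrightarrow>
        xs ! count_list (take i w) North < xs ! Suc (count_list (take i w) North))"

lemma labels_fit_iff:
  "(\<forall>i a b. Suc i < length p \<and> p ! i = LNorth a \<and> p ! Suc i = LNorth b \<longrightarrow> a < b) \<longleftrightarrow>
     labels_fit (map unlabel p) (north_labels p)"
proof -
  let ?w = "map unlabel p"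
  have "(\<forall>a b. p ! i = LNorth a \<and> p ! Suc i = LNorth b \<longrightarrow> a < b) \<longleftrightarrow>
      (?w ! i = North \<and> ?w ! Suc i = North \<longrightarrow>
        north_labels p ! count_list (take i ?w) North
          < north_labels p ! Suc (count_list (take i ?w) North))" (is "?L \<longleftrightarrow> ?R")
    if i: "Suc i < length p" for i
  proof (cases "?w ! i = North \<and> ?w ! Suc i = North")
    case True
    then have "p ! i = LNorth (north_labels p ! count_list (take i ?w) North)"
      using nth_labelled_north[of i p] i by simp
    moreover have "p ! Suc i = LNorth (north_labels p ! Suc (count_list (take i ?w) North))"
      using nth_labelled_north[of "Suc i" p] i True take_Suc_conv_app_nth[of i ?w] by simp
    ultimately show ?thesis
      using True by simp
  next
    case False
    then show ?thesis
      using i by auto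
  qed
  then show ?thesis
    unfolding labels_fit_def by (metis length_map)
qed

lemma exists_nth_north:
  assumes "1 \<le> m" "m \<le> count_list w North"
  shows "\<exists>i<length w. w ! i = North \<and> count_list (take (Suc i) w) North = m"
  using assms
proof (induction w arbitrary: m)
  case (Cons s w)
  show ?case
  proof (cases "s = North \<and> m = 1")
    case True
    then show ?thesis by (intro exI[of _ 0]) simp
  next
    case False
    define m' where "m' = (if s = North then m - 1 else m)"
    have "1 \<le> m'" "m' \<le> count_list w North"
      using Cons.prems False by (auto simp: m'_def)
    from Cons.IH[OF this] obtain i
      where "i < length w" "w ! i = North" "count_list (take (Suc i) w) North = m'"
      by blast
    then show ?thesis
      using Cons.prems by (intro exI[of _ "Suc i"]) (auto simp: m'_def)
  qed
qed simp

text \<open>This makes the position of the \<open>m\<close>-th north step unique.\<close>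

lemma count_list_take_strict_mono:
  assumes "i < j" "j < length w" "w ! j = s"
  shows "count_list (take (Suc i) w) s < count_list (take (Suc j) w) s"
proof -
  have "count_list (take j w) s = count_list (take (Suc i) w) s + count_list (drop (Suc i) (take j w)) s"
    using assms by (metis append_take_drop_id count_list_append min.absorb1 Suc_leI take_take)
  then show ?thesis
    using assms by (simp add: take_Suc_conv_app_nth)
qed

text \<open>Both label indices compared in \<open>labels_fit\<close> are therefore valid positions
  in a list with one label per north step.\<close>

lemma consecutive_norths_bound:
  assumes "Suc i < length w" "w ! i = North" "w ! Suc i = North"
  shows "Suc (count_list (take i w) North) < count_list w North"
  using assms count_list_take_strict_mono[of i "Suc i" w North]
    count_list_append[of "take (Suc (Suc i)) w" "drop (Suc (Suc i)) w" North]
  by (simp add: take_Suc_conv_app_nth[of i])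

text \<open>Labels fail to increase only from the \<open>m\<close>-th to the next north step, so the
  sole obstruction is that these two steps are adjacent.\<close>

lemma labels_fit_single_descent:
  assumes m: "1 \<le> m" "m < count_list w North"
    and asc: "\<And>j. Suc j < count_list w North \<Longrightarrow> xs ! j < xs ! Suc j \<longleftrightarrow> Suc j \<noteq> m"
  shows "labels_fit w xs \<longleftrightarrow> north_then_east m w"
proof -
  have count: "Suc (count_list (take i w) North) = count_list (take (Suc i) w) North"
    if "i < length w" "w ! i = North" for i
    using that by (simp add: take_Suc_conv_app_nth)
  obtain i where i: "i < length w" "w ! i = North" "count_list (take (Suc i) w) North = m"
    using exists_nth_north[of m w] m by auto
  \<comment> \<open>Since \<open>m\<close> is less than the number of north steps, the
    \<open>m\<close>-th one is not the last step of the word.\<close>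
  have Si: "Suc i < length w"
    using i m by (metis Suc_lessI less_irrefl take_all_iff order_refl)
  have uniq: "j = i" if "j < length w" "w ! j = North" "count_list (take (Suc j) w) North = m" for j
    using count_list_take_strict_mono[of i j w North] count_list_take_strict_mono[of j i w North]
      i that by (metis less_irrefl linorder_neqE_nat)
  have "labels_fit w xs \<longleftrightarrow> (\<forall>j. Suc j < length w \<and> w ! j = North \<and> w ! Suc j = North \<longrightarrow>
          count_list (take (Suc j) w) North \<noteq> m)"
    unfolding labels_fit_def using asc consecutive_norths_bound[of _ w] count by (metis Suc_lessD)
  also have "\<dots> \<longleftrightarrow> w ! Suc i \<noteq> North"
    using i Si uniq by (metis Suc_lessD)
  also have "\<dots> \<longleftrightarrow> w ! Suc i = East"
    by (cases "w ! Suc i") auto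
  also have "\<dots> \<longleftrightarrow> north_then_east m w"
    unfolding north_then_east_def using i Si uniq by (metis Suc_lessD)
  finally show ?thesis .
qed

lemma labels_fit_identity:
  assumes "count_list w North = n"
  shows "labels_fit w [1..<n + 1]"
  unfolding labels_fit_def
proof (intro allI impI, elim conjE)
  fix i assume i: "Suc i < length w" "w ! i = North" "w ! Suc i = North"
  have "Suc (count_list (take i w) North) < n"
    using consecutive_norths_bound[OF i] assms by simp
  then show "[1..<n + 1] ! count_list (take i w) North
      < [1..<n + 1] ! Suc (count_list (take i w) North)"
    by (simp del: upt_Suc)
qed

section \<open>Summation over the avoiding permutations\<close>

text \<open>A parking function corresponds to the pair of its label word and its path; the pairs are
  then counted permutation by permutation.\<close>

lemma pf_eq_sum:
  "pf n [[1, 3, 2], [3, 2, 1]] = (\<Sum>\<pi>\<in>avoiders n. card {w. dyck_path n w \<and> labels_fit w \<pi>})"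
proof -
  let ?S = "SIGMA \<pi>:avoiders n. {w. dyck_path n w \<and> labels_fit w \<pi>}"
  let ?P = "{p. parking_function n p \<and>
    (\<forall>\<rho>\<in>set [[1, 3, 2], [3, 2, 1]]. avoids_pattern (north_labels p) \<rho>)}"
  have len: "length \<pi> = n" if "\<pi> \<in> avoiders n" for \<pi>
    using that by (metis (mono_tags, lifting) avoiders_def card_atLeastAtMost diff_Suc_1
        distinct_card mem_Collect_eq)
  have mem: "p \<in> ?P \<longleftrightarrow> (north_labels p, map unlabel p) \<in> ?S" for p
    by (auto simp: parking_function_def labels_fit_iff avoiders_def)
  have "bij_betw (\<lambda>p. (north_labels p, map unlabel p)) ?P ?S"
  proof (rule bij_betw_byWitness[where f' = "\<lambda>(\<pi>, w). label_path w \<pi>"])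
    show "\<forall>p\<in>?P. (case (north_labels p, map unlabel p) of (\<pi>, w) \<Rightarrow> label_path w \<pi>) = p"
      by (simp add: label_path_unlabel)
    show inv: "\<forall>x\<in>?S. (north_labels (case x of (\<pi>, w) \<Rightarrow> label_path w \<pi>),
        map unlabel (case x of (\<pi>, w) \<Rightarrow> label_path w \<pi>)) = x"
      by (auto simp: unlabel_label_path north_labels_label_path len dyck_path_def)
    show "(\<lambda>p. (north_labels p, map unlabel p)) ` ?P \<subseteq> ?S"
      using mem by blast
    show "(\<lambda>(\<pi>, w). label_path w \<pi>) ` ?S \<subseteq> ?P"
    proof (intro image_subsetI)
      fix x assume "x \<in> ?S"
      then show "(\<lambda>(\<pi>, w). label_path w \<pi>) x \<in> ?P"
        \<comment> \<open>By \<open>inv\<close>, splitting the relabelled path returns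
          \<open>x\<close>, so \<open>mem\<close> turns membership of \<open>x\<close> into
          membership of that path.\<close>
        using inv unfolding mem by metis
    qed
  qed
  then have "pf n [[1, 3, 2], [3, 2, 1]] = card ?S"
    unfolding pf_def by (rule bij_betw_same_card)
  also have "\<dots> = (\<Sum>\<pi>\<in>avoiders n. card {w. dyck_path n w \<and> labels_fit w \<pi>})"
  proof (rule card_SigmaI)
    show "finite (avoiders n)"
      by (simp add: avoiders_eq)
    show "\<forall>\<pi>\<in>avoiders n. finite {w. dyck_path n w \<and> labels_fit w \<pi>}"
      using finite_dyck_paths[of n] by (auto elim: rev_finite_subset)
  qed
  finally show ?thesis .
qed

theorem theorem24:
  fixes n :: nat
  assumes "n \<ge> 1"
  shows "real (pf n [[1, 3, 2], [3, 2, 1]]) =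
           catalan n + (\<Sum>m = 1..n - 1. (real n - real m) * real (h n m))"
proof -
  let ?F = "\<lambda>\<pi>. card {w. dyck_path n w \<and> labels_fit w \<pi>}"
  let ?S = "SIGMA m:{1..n - 1}. {1..n - m}"
  have identity: "?F [1..<n + 1] = card {w. dyck_path n w}"
    using labels_fit_identity by (metis dyck_path_def)
  have rotated: "?F (rotated n m c) = h n m" if "m \<in> {1..n - 1}" "c \<in> {1..n - m}" for m c
  proof -
    have "labels_fit w (rotated n m c) \<longleftrightarrow> north_then_east m w" if "dyck_path n w" for w
    proof (rule labels_fit_single_descent)
      show "1 \<le> m" "m < count_list w North"
        using that \<open>m \<in> _\<close> by (auto simp: dyck_path_def)
      show "rotated n m c ! j < rotated n m c ! Suc j \<longleftrightarrow> Suc j \<noteq> m"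
        if "Suc j < count_list w North" for j
        using that \<open>dyck_path n w\<close> \<open>m \<in> _\<close> \<open>c \<in> _\<close>
        by (intro rotated_ascent_iff) (auto simp: dyck_path_def)
    qed
    then show ?thesis
      unfolding h_def by metis
  qed
  have "pf n [[1, 3, 2], [3, 2, 1]] =
      ?F [1..<n + 1] + sum ?F ((\<lambda>(m, c). rotated n m c) ` ?S)"
    unfolding pf_eq_sum avoiders_eq
    by (rule sum.insert[OF _ identity_not_rotated]) simp
  also have "sum ?F ((\<lambda>(m, c). rotated n m c) ` ?S) = (\<Sum>(m, c)\<in>?S. ?F (rotated n m c))"
    by (subst sum.reindex[OF inj_on_rotated]) (simp add: case_prod_unfold)
  also have "\<dots> = (\<Sum>m = 1..n - 1. \<Sum>c = 1..n - m. ?F (rotated n m c))"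
    by (subst sum.Sigma) auto
  \<comment> \<open>The inner summand does not depend on \<open>c\<close>, which takes
    \<open>n - m\<close> values.\<close>
  also have "\<dots> = (\<Sum>m = 1..n - 1. (n - m) * h n m)"
    using rotated by (intro sum.cong) auto
  finally have "real (pf n [[1, 3, 2], [3, 2, 1]]) =
      catalan n + (\<Sum>m = 1..n - 1. real ((n - m) * h n m))"
    unfolding identity by (simp add: card_dyck_paths)
  \<comment> \<open>In this range \<open>m \<le> n\<close>, so the truncated difference agrees with
    the real one.\<close>
  also have "(\<Sum>m = 1..n - 1. real ((n - m) * h n m)) =
      (\<Sum>m = 1..n - 1. (real n - real m) * real (h n m))"
    using assms by (intro sum.cong) auto
  finally show ?thesis .
qed

end
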